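(* Let $G,D$ be two points of the Euclidean plane at distance $GD=2c$, and let $(x,y)$ be Cartesian coordinates with origin at the midpoint of $GD$ and $x$-axis along the line $GD$. The pencil of (orthogonal) circles with two base points $G,D$ and the family of confocal conics with foci $G,D$ follow a similar description in two parameters $t,T$: (circles) $$\frac{x}{\frac1t+t}=\frac{y}{\frac1T-T}=\frac{c}{\frac Tt+\frac tT},$$ where $t=\text{const}$ describes the elliptic circles passing through $G,D$, and $T=\text{const}$ describes the hyperbolic circles with limiting points $G,D$; (conics) $$\frac{x}{\frac1t+t}=\frac{y}{\frac1T-T}=\frac{2c}{\left(\frac1t-t\right)\left(\frac1T+T\right)},$$ where $t=\text{const}$ describes the ellipses with foci $G,D$, and $T=\text{const}$ describes the hyperbolas with foci $G,D$.
   Context: The Apollonian circles of $G,D$ form two mutually orthogonal families: the "elliptic" circles, which pass through both $G$ and $D$, and the "hyperbolic" circles, which have $G$ and $D$ as limiting points. Confocal conics with foci $G,D$ are the ellipses and hyperbolas having $G$ and $D$ as their two foci. *)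

theory Defs
  imports "HOL-Analysis.Analysis"
begin

text \<open>
  Either orientation of the two axes is allowed, so the abscissa of \<open>D\<close> may be \<open>c\<close> or \<open>-c\<close>.
\<close>

definition cartesian_coords ::
    "real^2 \<Rightarrow> real^2 \<Rightarrow> (real^2 \<Rightarrow> real) \<Rightarrow> (real^2 \<Rightarrow> real) \<Rightarrow> bool" where
  "cartesian_coords G D x y \<longleftrightarrow>
     (\<exists>u v. norm u = 1 \<and> norm v = 1 \<and> u \<bullet> v = 0 \<and> D - G \<in> span {u} \<and>
            (\<forall>P. x P = (P - midpoint G D) \<bullet> u) \<and>
            (\<forall>P. y P = (P - midpoint G D) \<bullet> v))"

definition elliptic_circle :: "real^2 \<Rightarrow> real^2 \<Rightarrow> (real^2) set \<Rightarrow> bool" where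
  "elliptic_circle G D S \<longleftrightarrow> (\<exists>a r. r > 0 \<and> S = sphere a r \<and> G \<in> S \<and> D \<in> S)"

definition circle_power :: "real^2 \<Rightarrow> real \<Rightarrow> real^2 \<Rightarrow> real" where
  "circle_power a r P = (dist P a)\<^sup>2 - r\<^sup>2"

text \<open>
  The limiting points of a pencil of circles are its circles of radius zero, so the pencil
  with limiting points \<open>G\<close> and \<open>D\<close> is the one spanned by these two point circles. The circles
  of positive radius in it are the hyperbolic circles; its line, the perpendicular bisector
  of \<open>GD\<close>, is not a circle.
\<close>

definition hyperbolic_circle :: "real^2 \<Rightarrow> real^2 \<Rightarrow> (real^2) set \<Rightarrow> bool" where
  "hyperbolic_circle G D S \<longleftrightarrow>
     (\<exists>a r. r > 0 \<and> S = sphere a r \<and>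
        (\<exists>l m. \<forall>P. circle_power a r P = l * circle_power G 0 P + m * circle_power D 0 P))"

definition orthogonal_circles :: "(real^2) set \<Rightarrow> (real^2) set \<Rightarrow> bool" where
  "orthogonal_circles S S' \<longleftrightarrow>
     (\<exists>a r b s. r > 0 \<and> s > 0 \<and> S = sphere a r \<and> S' = sphere b s \<and>
        S \<inter> S' \<noteq> {} \<and> (\<forall>P \<in> S \<inter> S'. (P - a) \<bullet> (P - b) = 0))"

definition ellipse_with_foci :: "real^2 \<Rightarrow> real^2 \<Rightarrow> (real^2) set \<Rightarrow> bool" where
  "ellipse_with_foci F F' S \<longleftrightarrow>
     (\<exists>a. dist F F' < 2 * a \<and> S = {P. dist P F + dist P F' = 2 * a})"

definition hyperbola_with_foci :: "real^2 \<Rightarrow> real^2 \<Rightarrow> (real^2) set \<Rightarrow> bool" where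
  "hyperbola_with_foci F F' S \<longleftrightarrow>
     (\<exists>a. 0 < a \<and> 2 * a < dist F F' \<and> S = {P. \<bar>dist P F - dist P F'\<bar> = 2 * a})"

text \<open>
  The continued proportion \<open>x/A = y/B = w/C\<close>. A vanishing denominator forces its numerator
  to vanish, instead of giving the value \<open>0\<close> of division by zero in HOL; this matters for
  \<open>1/T - T\<close> at \<open>T = 1\<close> and \<open>T = -1\<close>, which give the points \<open>G\<close> and \<open>D\<close> of the elliptic circles.
\<close>

definition proportional3 ::
    "real \<Rightarrow> real \<Rightarrow> real \<Rightarrow> real \<Rightarrow> real \<Rightarrow> real \<Rightarrow> bool" where
  "proportional3 x A y B w C \<longleftrightarrow> (\<exists>k. x = k * A \<and> y = k * B \<and> w = k * C)"

definition circles_eq :: "real \<Rightarrow> real \<Rightarrow> real \<Rightarrow> real \<Rightarrow> real \<Rightarrow> bool" where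
  "circles_eq c t T x y \<longleftrightarrow>
     proportional3 x (1/t + t) y (1/T - T) c (T/t + t/T)"

definition conics_eq :: "real \<Rightarrow> real \<Rightarrow> real \<Rightarrow> real \<Rightarrow> real \<Rightarrow> bool" where
  "conics_eq c t T x y \<longleftrightarrow>
     proportional3 x (1/t + t) y (1/T - T) (2 * c) ((1/t - t) * (1/T + T))"

text \<open>
  The curves \<open>t = const\<close> and \<open>T = const\<close> of a two-parameter equation \<open>E t T x y\<close>, the other
  parameter running through the nonzero reals.
\<close>

definition t_curve ::
    "(real \<Rightarrow> real \<Rightarrow> real \<Rightarrow> real \<Rightarrow> bool) \<Rightarrow> (real^2 \<Rightarrow> real) \<Rightarrow> (real^2 \<Rightarrow> real)
      \<Rightarrow> real \<Rightarrow> (real^2) set" where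
  "t_curve E x y t = {P. \<exists>T. T \<noteq> 0 \<and> E t T (x P) (y P)}"

definition T_curve ::
    "(real \<Rightarrow> real \<Rightarrow> real \<Rightarrow> real \<Rightarrow> bool) \<Rightarrow> (real^2 \<Rightarrow> real) \<Rightarrow> (real^2 \<Rightarrow> real)
      \<Rightarrow> real \<Rightarrow> (real^2) set" where
  "T_curve E x y T = {P. \<exists>t. t \<noteq> 0 \<and> E t T (x P) (y P)}"

text \<open>
  The parametrised curves omit the two points that correspond to the values \<open>0\<close> and \<open>\<infinity>\<close> of
  the running parameter. They lie on one coordinate axis, the zero set of \<open>z\<close> below, and are
  restored by the closure. So \<open>describes C I z F\<close> says that the completed curves \<open>C s\<close>, with
  \<open>s\<close> in \<open>I\<close>, are exactly the members of the family \<open>F\<close>, and that each \<open>C s\<close> is the whole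
  completed curve except for its points on that axis.
\<close>

definition describes ::
    "(real \<Rightarrow> (real^2) set) \<Rightarrow> real set \<Rightarrow> (real^2 \<Rightarrow> real) \<Rightarrow> ((real^2) set \<Rightarrow> bool) \<Rightarrow> bool" where
  "describes C I z F \<longleftrightarrow>
     {closure (C s) | s. s \<in> I} = {S. F S} \<and>
     (\<forall>s\<in>I. C s = {P \<in> closure (C s). z P \<noteq> 0})"

end

theory Submission
  imports Defs
begin

text \<open>
  Solving the continued proportions gives explicit coordinates: for the circles
  \<open>x = c T (1 + t\<^sup>2) / (T\<^sup>2 + t\<^sup>2)\<close>, \<open>y = c t (1 - T\<^sup>2) / (T\<^sup>2 + t\<^sup>2)\<close>, and for the conics
  \<open>x = c A B\<close>, \<open>y = c A' B'\<close>, where \<open>(A, A') = ((1 + t\<^sup>2) / (1 - t\<^sup>2), 2 t / (1 - t\<^sup>2))\<close> lies on the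
  hyperbola \<open>A\<^sup>2 - A'\<^sup>2 = 1\<close> and \<open>(B, B') = (2 T / (1 + T\<^sup>2), (1 - T\<^sup>2) / (1 + T\<^sup>2))\<close> on the unit circle.
  So each of the four statements on curves splits into three independent parts.

  Elimination. Removing the running parameter gives the equation of a curve:
  \<open>x\<^sup>2 + y\<^sup>2 - c\<^sup>2 = c (1/t - t) y\<close> or \<open>x\<^sup>2 + y\<^sup>2 + c\<^sup>2 = c (1/T + T) x\<close> for the circles, and for both
  kinds of conics \<open>(a\<^sup>2 - c\<^sup>2) x\<^sup>2 + a\<^sup>2 y\<^sup>2 = a\<^sup>2 (a\<^sup>2 - c\<^sup>2)\<close>, where \<open>a = c A\<close> or \<open>a = c B\<close>.
  Conversely the parameter is a rational function of the point wherever the coordinate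
  that is required to be nonzero does not vanish: up to a constant factor it is the slope,
  or the inverse slope, of the line from the point to a fixed point of the curve.

  Families. As the fixed parameter varies, these equations give every member of the
  classical family. For the circles this determines centre and radius from the base
  points or from the pencil relation. For the conics, with \<open>g\<close> and \<open>d\<close> the distances to the
  foci, the product \<open>((g + d)\<^sup>2 - 4 a\<^sup>2) ((g - d)\<^sup>2 - 4 a\<^sup>2)\<close> is a constant multiple of the
  difference of the two sides of the equation above (\<open>confocal_conic_iff\<close>), and the triangle inequality tells which factor can vanish.

  Closure. All four curves are symmetric about one axis and have an equation
  \<open>(w - m)\<^sup>2 = R (1 + \<kappa> z\<^sup>2)\<close> in the two coordinates. Near a point with \<open>z = 0\<close> such a curve is a
  graph over \<open>z\<close>, so the points omitted by the parametrisation are limits of the others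
  (\<open>closure_off_axis\<close>).

  Orthogonality is then a sum of two equations: at a common point of the circles with
  centres \<open>(0, b)\<close> and \<open>(d, 0)\<close>, adding \<open>x\<^sup>2 + y\<^sup>2 - c\<^sup>2 = 2 b y\<close> and \<open>x\<^sup>2 + y\<^sup>2 + c\<^sup>2 = 2 d x\<close> gives
  \<open>x (x - d) + (y - b) y = 0\<close>; a common point exists because the parameters \<open>t, T\<close> name one.
\<close>

section \<open>Orthonormal frames of the plane\<close>

lemma orthonormal_expansion:
  fixes u v P :: "real^2"
  assumes "norm u = 1" "norm v = 1" "u \<bullet> v = 0"
  shows "P = (P \<bullet> u) *\<^sub>R u + (P \<bullet> v) *\<^sub>R v"
proof -
  define w where "w = P - (P \<bullet> u) *\<^sub>R u - (P \<bullet> v) *\<^sub>R v"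
  have uu: "u \<bullet> u = 1" and vv: "v \<bullet> v = 1"
    using assms by (simp_all add: dot_square_norm)
  have "u \<noteq> v" using assms(3) uu by auto
  have indep: "independent {u, v}"
    using assms uu vv by (intro pairwise_orthogonal_independent)
      (auto simp: pairwise_def orthogonal_def inner_commute)
  have "UNIV \<subseteq> span {u, v}"
    using indep \<open>u \<noteq> v\<close> card_eq_dim[of "{u, v}" UNIV] by simp
  moreover have "w \<bullet> u = 0" "w \<bullet> v = 0"
    using assms(3) uu vv by (simp_all add: w_def inner_diff_left inner_commute[of v u])
  then have "orthogonal w z" if "z \<in> span {u, v}" for z
    by (intro orthogonal_to_span[OF that]) (auto simp: orthogonal_def)
  ultimately have "orthogonal w w" by blast
  then have "w = 0" by (simp add: orthogonal_def)
  then show ?thesis by (simp add: w_def algebra_simps)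
qed

text \<open>
  A point of \<open>K\<close> on the axis \<open>z = 0\<close> at height \<open>h\<close> satisfies \<open>(h - m)\<^sup>2 = R\<close>. Hence
  \<open>s \<mapsto> m + (h - m) sqrt (1 + \<kappa> s\<^sup>2)\<close> is a continuous arc of \<open>K\<close> over \<open>z = s\<close> that reaches the
  point at \<open>s = 0\<close>, with no case distinction on the sign of \<open>h - m\<close>. Taking \<open>\<kappa> < 0\<close> gives the
  circles and ellipses, and \<open>\<kappa> > 0\<close> the hyperbolas with the omitted points as vertices.
\<close>

lemma closure_off_axis:
  fixes M u v :: "real^2" and m R \<kappa> :: real
  assumes "norm u = 1" "norm v = 1" "u \<bullet> v = 0"
    and K: "K = {P. ((P - M) \<bullet> v - m)\<^sup>2 = R * (1 + \<kappa> * ((P - M) \<bullet> u)\<^sup>2)}"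
  shows "closure {P \<in> K. (P - M) \<bullet> u \<noteq> 0} = K"
proof
  have "closed K"
    unfolding K by (intro closed_Collect_eq continuous_intros)
  then show "closure {P \<in> K. (P - M) \<bullet> u \<noteq> 0} \<subseteq> K"
    by (intro closure_minimal) auto
next
  show "K \<subseteq> closure {P \<in> K. (P - M) \<bullet> u \<noteq> 0}"
  proof
    fix P assume "P \<in> K"
    have uu: "u \<bullet> u = 1" and vv: "v \<bullet> v = 1" and vu: "v \<bullet> u = 0"
      using assms by (simp_all add: dot_square_norm inner_commute)
    show "P \<in> closure {P \<in> K. (P - M) \<bullet> u \<noteq> 0}"
    proof (cases "(P - M) \<bullet> u = 0")
      case False
      then show ?thesis using \<open>P \<in> K\<close> by (intro subsetD[OF closure_subset]) auto
    next
      case True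
      define h where "h = (P - M) \<bullet> v"
      have h: "(h - m)\<^sup>2 = R"
        using \<open>P \<in> K\<close> True by (simp add: K h_def)
      have P: "P = M + h *\<^sub>R v"
        using orthonormal_expansion[OF assms(1-3), of "P - M"] True
        by (simp add: h_def algebra_simps)
      define \<gamma> where "\<gamma> s = M + s *\<^sub>R u + (m + (h - m) * sqrt (1 + \<kappa> * s\<^sup>2)) *\<^sub>R v" for s
      have "(\<gamma> \<longlongrightarrow> M + 0 *\<^sub>R u + (m + (h - m) * sqrt (1 + \<kappa> * 0\<^sup>2)) *\<^sub>R v) (at 0)"
        unfolding \<gamma>_def by (intro tendsto_intros)
      then have lim: "(\<gamma> \<longlongrightarrow> P) (at 0)"
        by (simp add: P)
      have "((\<lambda>s. 1 + \<kappa> * s\<^sup>2) \<longlongrightarrow> 1 + \<kappa> * 0\<^sup>2) (at 0)"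
        by (intro tendsto_intros)
      then have "\<forall>\<^sub>F s in at 0. 0 < 1 + \<kappa> * s\<^sup>2"
        by (rule order_tendstoD) simp
      moreover have "\<forall>\<^sub>F s::real in at 0. s \<noteq> 0"
        by (rule eventually_neq_at_within)
      ultimately have "\<forall>\<^sub>F s in at 0. \<gamma> s \<in> {P \<in> K. (P - M) \<bullet> u \<noteq> 0}"
      proof eventually_elim
        case (elim s)
        then show ?case
          using h assms(3) by (simp add: K \<gamma>_def inner_add_left uu vv vu power_mult_distrib)
      qed
      then have "\<forall>\<^sub>F s in at 0. \<gamma> s \<in> closure {P \<in> K. (P - M) \<bullet> u \<noteq> 0}"
        by (rule eventually_mono) (rule subsetD[OF closure_subset])
      then show ?thesis
        using Lim_in_closed_set[OF closed_closure _ _ lim] by (simp add: trivial_limit_at)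
    qed
  qed
qed

text \<open>
  With the completed curves \<open>K s\<close> given by equations, the three parts of \<open>describes\<close>
  become elimination of the parameter, density off the axis, and classification.
\<close>

lemma describesI:
  assumes "\<And>s. s \<in> I \<Longrightarrow> C s = {P \<in> K s. z P \<noteq> 0}"
    and "\<And>s. s \<in> I \<Longrightarrow> closure {P \<in> K s. z P \<noteq> 0} = K s"
    and "\<And>S. F S \<longleftrightarrow> (\<exists>s\<in>I. S = K s)"
  shows "describes C I z F"
proof -
  have *: "closure (C s) = K s" if "s \<in> I" for s
    using assms(1,2)[OF that] by simp
  have "{closure (C s) | s. s \<in> I} = {S. F S}"
    using * by (auto simp: assms(3))
  then show ?thesis
    using assms(1) * by (simp add: describes_def)
qed

text \<open>Puts the equations of circles into the shape that \<open>closure_off_axis\<close> asks for.\<close>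

lemma rescale: "n * (1 + (- 1 / n) * z) = n - z" if "n \<noteq> 0" for n z :: real
  using that by (simp add: field_simps)

section \<open>Solving the continued proportions\<close>

lemma proportional3_iff:
  assumes "C \<noteq> 0"
  shows "proportional3 X A Y B w C \<longleftrightarrow> X = w / C * A \<and> Y = w / C * B"
  using assms by (auto simp: proportional3_def intro!: exI[of _ "w / C"])

lemma circles_eq_iff:
  assumes "t \<noteq> 0" "T \<noteq> 0"
  shows "circles_eq c t T X Y \<longleftrightarrow>
    X = c * T * (1 + t\<^sup>2) / (T\<^sup>2 + t\<^sup>2) \<and> Y = c * t * (1 - T\<^sup>2) / (T\<^sup>2 + t\<^sup>2)"
proof -
  have C: "T / t + t / T = (T\<^sup>2 + t\<^sup>2) / (t * T)"
    using assms by (simp add: field_simps power2_eq_square)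
  have nz: "T\<^sup>2 + t\<^sup>2 \<noteq> 0"
    using assms by (simp add: sum_power2_eq_zero_iff)
  have X: "c / ((T\<^sup>2 + t\<^sup>2) / (t * T)) * (1 / t + t) = c * T * (1 + t\<^sup>2) / (T\<^sup>2 + t\<^sup>2)"
    using assms nz by (simp add: divide_simps) (simp add: power2_eq_square algebra_simps)
  have Y: "c / ((T\<^sup>2 + t\<^sup>2) / (t * T)) * (1 / T - T) = c * t * (1 - T\<^sup>2) / (T\<^sup>2 + t\<^sup>2)"
    using assms nz by (simp add: divide_simps) (simp add: power2_eq_square algebra_simps)
  show ?thesis
    unfolding circles_eq_def C X[symmetric] Y[symmetric]
    by (rule proportional3_iff) (use assms nz in simp)
qed

lemma square_eq_1: "t\<^sup>2 \<noteq> 1" if "t \<notin> {0, 1, -1}" for t :: real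
  using that by (auto simp: power2_eq_1_iff)

lemma one_plus_square_nonzero [simp]: "1 + (t::real)\<^sup>2 \<noteq> 0"
  using zero_le_power2[of t] by linarith

text \<open>
  For \<open>t\<^sup>2 = 1\<close> the third denominator vanishes and the proportion has no solution, as
  \<open>2 c \<noteq> 0\<close>: these values of \<open>t\<close> are the points at infinity of the hyperbolas.
\<close>

lemma conics_eq_iff:
  assumes "t \<noteq> 0" "T \<noteq> 0" "c \<noteq> 0"
  shows "conics_eq c t T X Y \<longleftrightarrow> t\<^sup>2 \<noteq> 1 \<and>
    X = c * ((1 + t\<^sup>2) / (1 - t\<^sup>2)) * (2 * T / (1 + T\<^sup>2)) \<and>
    Y = c * (2 * t / (1 - t\<^sup>2)) * ((1 - T\<^sup>2) / (1 + T\<^sup>2))"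
proof (cases "t\<^sup>2 = 1")
  case True
  then have "1 / t - t = 0"
    using assms by (simp add: field_simps power2_eq_square)
  then show ?thesis
    using True assms(3) by (simp add: conics_eq_def proportional3_def)
next
  case False
  have C: "(1 / t - t) * (1 / T + T) = (1 - t\<^sup>2) * (1 + T\<^sup>2) / (t * T)"
    using assms by (simp add: field_simps power2_eq_square)
  have nz: "1 - t\<^sup>2 \<noteq> 0" "1 + T\<^sup>2 \<noteq> 0"
    using False by auto
  have X: "2 * c / ((1 - t\<^sup>2) * (1 + T\<^sup>2) / (t * T)) * (1 / t + t)
      = c * ((1 + t\<^sup>2) / (1 - t\<^sup>2)) * (2 * T / (1 + T\<^sup>2))"
    using assms nz by (simp add: divide_simps) (simp add: power2_eq_square algebra_simps)
  have Y: "2 * c / ((1 - t\<^sup>2) * (1 + T\<^sup>2) / (t * T)) * (1 / T - T)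
      = c * (2 * t / (1 - t\<^sup>2)) * ((1 - T\<^sup>2) / (1 + T\<^sup>2))"
    using assms nz by (simp add: divide_simps) (simp add: power2_eq_square algebra_simps)
  have "conics_eq c t T X Y \<longleftrightarrow>
     X = 2 * c / ((1 - t\<^sup>2) * (1 + T\<^sup>2) / (t * T)) * (1 / t + t) \<and>
     Y = 2 * c / ((1 - t\<^sup>2) * (1 + T\<^sup>2) / (t * T)) * (1 / T - T)"
    unfolding conics_eq_def C by (rule proportional3_iff) (use assms nz in simp)
  then show ?thesis
    unfolding X Y using False by simp
qed

section \<open>Rational parametrisations\<close>

text \<open>
  Projection from the point \<open>(0, 1)\<close> of the circle, which corresponds to \<open>T = 0\<close>; the
  opposite point \<open>(0, -1)\<close> corresponds to \<open>T = \<infinity>\<close>.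
\<close>

lemma unit_circle_rational:
  fixes X Y :: real
  shows "(\<exists>T. T \<noteq> 0 \<and> X = 2 * T / (1 + T\<^sup>2) \<and> Y = (1 - T\<^sup>2) / (1 + T\<^sup>2)) \<longleftrightarrow>
    X \<noteq> 0 \<and> X\<^sup>2 + Y\<^sup>2 = 1"
proof
  assume "\<exists>T. T \<noteq> 0 \<and> X = 2 * T / (1 + T\<^sup>2) \<and> Y = (1 - T\<^sup>2) / (1 + T\<^sup>2)"
  then obtain T where T: "T \<noteq> 0" "X = 2 * T / (1 + T\<^sup>2)" "Y = (1 - T\<^sup>2) / (1 + T\<^sup>2)" by blast
  have "X\<^sup>2 + Y\<^sup>2 = ((2 * T)\<^sup>2 + (1 - T\<^sup>2)\<^sup>2) / (1 + T\<^sup>2)\<^sup>2"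
    unfolding T by (simp add: power_divide add_divide_distrib)
  also have "(2 * T)\<^sup>2 + (1 - T\<^sup>2)\<^sup>2 = (1 + T\<^sup>2)\<^sup>2"
    by algebra
  finally show "X \<noteq> 0 \<and> X\<^sup>2 + Y\<^sup>2 = 1"
    using T by simp
next
  assume *: "X \<noteq> 0 \<and> X\<^sup>2 + Y\<^sup>2 = 1"
  define T where "T = (1 - Y) / X"
  have TX: "T * X = 1 - Y" using * by (simp add: T_def)
  have "Y \<noteq> 1" using * by auto
  then have "T \<noteq> 0" using * by (simp add: T_def)
  have 1: "X * (1 + T\<^sup>2) = 2 * T"
  proof -
    have "X * (X * (1 + T\<^sup>2)) = X * (2 * T)" using TX * by algebra
    then show ?thesis using * by simp
  qed
  moreover have "Y * (1 + T\<^sup>2) = 1 - T\<^sup>2" using 1 TX by algebra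
  ultimately show "\<exists>T. T \<noteq> 0 \<and> X = 2 * T / (1 + T\<^sup>2) \<and> Y = (1 - T\<^sup>2) / (1 + T\<^sup>2)"
    using \<open>T \<noteq> 0\<close> by (intro exI[of _ T]) (simp add: eq_divide_eq)
qed

text \<open>
  Projection from the vertex \<open>(-1, 0)\<close>, which corresponds to \<open>t = \<infinity>\<close>; the vertex \<open>(1, 0)\<close>
  corresponds to \<open>t = 0\<close>, and the slopes \<open>\<plusminus> 1\<close> are those of the asymptotes.
\<close>

lemma unit_hyperbola_rational:
  fixes X Y :: real
  shows "(\<exists>t. t \<noteq> 0 \<and> t\<^sup>2 \<noteq> 1 \<and> X = (1 + t\<^sup>2) / (1 - t\<^sup>2) \<and> Y = 2 * t / (1 - t\<^sup>2)) \<longleftrightarrow>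
    Y \<noteq> 0 \<and> X\<^sup>2 - Y\<^sup>2 = 1"
proof
  assume "\<exists>t. t \<noteq> 0 \<and> t\<^sup>2 \<noteq> 1 \<and> X = (1 + t\<^sup>2) / (1 - t\<^sup>2) \<and> Y = 2 * t / (1 - t\<^sup>2)"
  then obtain t where t: "t \<noteq> 0" "t\<^sup>2 \<noteq> 1" "X = (1 + t\<^sup>2) / (1 - t\<^sup>2)" "Y = 2 * t / (1 - t\<^sup>2)"
    by blast
  have "X\<^sup>2 - Y\<^sup>2 = ((1 + t\<^sup>2)\<^sup>2 - (2 * t)\<^sup>2) / (1 - t\<^sup>2)\<^sup>2"
    unfolding t by (simp add: power_divide diff_divide_distrib)
  also have "(1 + t\<^sup>2)\<^sup>2 - (2 * t)\<^sup>2 = (1 - t\<^sup>2)\<^sup>2"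
    by algebra
  finally show "Y \<noteq> 0 \<and> X\<^sup>2 - Y\<^sup>2 = 1"
    using t by simp
next
  assume *: "Y \<noteq> 0 \<and> X\<^sup>2 - Y\<^sup>2 = 1"
  then have X1: "X + 1 \<noteq> 0" by (auto simp: add_eq_0_iff2)
  define t where "t = Y / (X + 1)"
  have tX: "t * (X + 1) = Y" using X1 by (simp add: t_def)
  have "t \<noteq> 0" using * X1 by (simp add: t_def)
  have "X\<^sup>2 - Y\<^sup>2 = 1" using * by blast
  then have "(X + 1) * (t\<^sup>2 * (X + 1)) = (X + 1) * (X - 1)"
    using tX by algebra
  then have 1: "t\<^sup>2 * (X + 1) = X - 1" using X1 by simp
  then have "t\<^sup>2 \<noteq> 1" by auto
  moreover have "X * (1 - t\<^sup>2) = 1 + t\<^sup>2" "Y * (1 - t\<^sup>2) = 2 * t"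
    using 1 tX by algebra+
  ultimately show "\<exists>t. t \<noteq> 0 \<and> t\<^sup>2 \<noteq> 1 \<and> X = (1 + t\<^sup>2) / (1 - t\<^sup>2) \<and> Y = 2 * t / (1 - t\<^sup>2)"
    using \<open>t \<noteq> 0\<close> by (intro exI[of _ t]) (simp add: eq_divide_eq)
qed

section \<open>Coordinates adapted to the two points\<close>

text \<open>
  Here the abscissa is oriented so that \<open>D\<close> is at \<open>c\<close>. The other orientation is the same
  locale with \<open>G\<close> and \<open>D\<close> exchanged, because the midpoint is symmetric.
\<close>

locale focal_frame =
  fixes G D u v :: "real^2" and c :: real and x y :: "real^2 \<Rightarrow> real"
  assumes c_pos: "c > 0"
    and norm_u: "norm u = 1" and norm_v: "norm v = 1" and orth: "u \<bullet> v = 0"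
    and D_minus_G: "D - G = (2 * c) *\<^sub>R u"
    and x_eq: "x P = (P - midpoint G D) \<bullet> u"
    and y_eq: "y P = (P - midpoint G D) \<bullet> v"
begin

definition pt :: "real \<Rightarrow> real \<Rightarrow> real^2" where
  "pt a b = midpoint G D + a *\<^sub>R u + b *\<^sub>R v"

lemma inner_uv [simp]: "u \<bullet> u = 1" "v \<bullet> v = 1" "u \<bullet> v = 0" "v \<bullet> u = 0"
  using norm_u norm_v orth by (simp_all add: dot_square_norm inner_commute)

lemma x_pt [simp]: "x (pt a b) = a" and y_pt [simp]: "y (pt a b) = b"
  by (simp_all add: x_eq y_eq pt_def inner_add_left)

lemma pt_xy [simp]: "pt (x P) (y P) = P"
  using orthonormal_expansion[OF norm_u norm_v orth, of "P - midpoint G D"]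
  by (simp add: pt_def x_eq y_eq algebra_simps)

lemma point_eq_iff: "P = Q \<longleftrightarrow> x P = x Q \<and> y P = y Q"
  by (metis pt_xy)

lemma inner_coords: "(P - A) \<bullet> (P - B) = (x P - x A) * (x P - x B) + (y P - y A) * (y P - y B)"
proof -
  have "Q - R = (x Q - x R) *\<^sub>R u + (y Q - y R) *\<^sub>R v" for Q R
    by (subst (1 2) pt_xy[symmetric]) (simp add: pt_def algebra_simps del: pt_xy)
  then show ?thesis
    by (simp add: inner_add_left inner_add_right)
qed

lemma dist_sq: "(dist P A)\<^sup>2 = (x P - x A)\<^sup>2 + (y P - y A)\<^sup>2"
  using inner_coords[of P A A] by (simp add: dist_norm dot_square_norm power2_eq_square)

lemma D_coords: "D = pt c 0" and G_coords: "G = pt (- c) 0"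
proof -
  have D: "D = G + (2 * c) *\<^sub>R u" using D_minus_G by (simp add: algebra_simps)
  have "midpoint G D = G + c *\<^sub>R u"
    by (simp add: vec_eq_iff midpoint_def D field_simps)
  moreover have "c *\<^sub>R u + c *\<^sub>R u = (2 * c) *\<^sub>R u"
    by (simp add: vec_eq_iff)
  ultimately have 1: "pt c 0 = G + (2 * c) *\<^sub>R u" and 2: "pt (- c) 0 = G"
    by (simp_all add: pt_def add.assoc)
  show "D = pt c 0"
    by (rule trans[OF D 1[symmetric]])
  show "G = pt (- c) 0"
    by (rule 2[symmetric])
qed

lemma xy_foci [simp]: "x D = c" "y D = 0" "x G = - c" "y G = 0"
  using x_pt[of c 0] y_pt[of c 0] x_pt[of "- c" 0] y_pt[of "- c" 0]
  unfolding D_coords[symmetric] G_coords[symmetric] by this+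

lemma mem_sphere_coords:
  assumes "r > 0"
  shows "P \<in> sphere a r \<longleftrightarrow> (x P - x a)\<^sup>2 + (y P - y a)\<^sup>2 = r\<^sup>2"
proof -
  have "P \<in> sphere a r \<longleftrightarrow> dist P a = r"
    by (simp add: dist_commute)
  also have "\<dots> \<longleftrightarrow> (dist P a)\<^sup>2 = r\<^sup>2"
    using assms by (intro power2_eq_iff_nonneg[symmetric]) simp_all
  finally show ?thesis unfolding dist_sq .
qed

lemma closure_off_y_axis:
  assumes "K = {P. (y P - m)\<^sup>2 = R * (1 + \<kappa> * (x P)\<^sup>2)}"
  shows "closure {P \<in> K. x P \<noteq> 0} = K"
  using closure_off_axis[OF norm_u norm_v orth assms[unfolded x_eq y_eq]] by (simp only: x_eq)

lemma closure_off_x_axis: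
  assumes "K = {P. (x P - m)\<^sup>2 = R * (1 + \<kappa> * (y P)\<^sup>2)}"
  shows "closure {P \<in> K. y P \<noteq> 0} = K"
  using closure_off_axis[OF norm_v norm_u inner_uv(4) assms[unfolded x_eq y_eq]] by (simp only: y_eq)

section \<open>The two families of circles\<close>

definition circle_through :: "real \<Rightarrow> (real^2) set" where
  "circle_through t = {P. (x P)\<^sup>2 + (y P)\<^sup>2 - c\<^sup>2 = c * (1 / t - t) * y P}"

definition circle_around :: "real \<Rightarrow> (real^2) set" where
  "circle_around T = {P. (x P)\<^sup>2 + (y P)\<^sup>2 + c\<^sup>2 = c * (1 / T + T) * x P}"

lemma circles_point_unique:
  assumes "t \<noteq> 0" "T \<noteq> 0"
  shows "\<exists>!P. circles_eq c t T (x P) (y P)"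
  unfolding circles_eq_iff[OF assms]
  by (rule ex1I[of _ "pt (c * T * (1 + t\<^sup>2) / (T\<^sup>2 + t\<^sup>2)) (c * t * (1 - T\<^sup>2) / (T\<^sup>2 + t\<^sup>2))"])
    (simp_all add: point_eq_iff)

text \<open>
  The value \<open>T = 0\<close> would give the point \<open>(0, c/t)\<close> of the circle; the slope of the line from
  there to the point with parameters \<open>t, T\<close> is \<open>- T / t\<close>, which gives \<open>T\<close> back from \<open>x, y\<close>.
\<close>

lemma t_curve_circles:
  assumes t: "t \<noteq> 0"
  shows "t_curve (circles_eq c) x y t = {P \<in> circle_through t. x P \<noteq> 0}"
proof (intro equalityI subsetI)
  fix P assume "P \<in> t_curve (circles_eq c) x y t"
  then obtain T where T: "T \<noteq> 0" "circles_eq c t T (x P) (y P)"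
    by (auto simp: t_curve_def)
  define n where "n = T\<^sup>2 + t\<^sup>2"
  have n: "n \<noteq> 0" using t by (simp add: n_def sum_power2_eq_zero_iff)
  have X: "x P = c * T * (1 + t\<^sup>2) / n" and Y: "y P = c * t * (1 - T\<^sup>2) / n"
    using T t by (simp_all add: circles_eq_iff n_def)
  have X': "n * x P = c * T * (1 + t\<^sup>2)" and Y': "n * y P = c * t * (1 - T\<^sup>2)"
    using X Y n by simp_all
  have "n\<^sup>2 * (t * ((x P)\<^sup>2 + (y P)\<^sup>2 - c\<^sup>2)) = n\<^sup>2 * (c * (1 - t\<^sup>2) * y P)"
    using X' Y' n_def by algebra
  then have "t * ((x P)\<^sup>2 + (y P)\<^sup>2 - c\<^sup>2) = c * (1 - t\<^sup>2) * y P"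
    using n by simp
  moreover have "x P \<noteq> 0" using X n c_pos T by simp
  ultimately show "P \<in> {P \<in> circle_through t. x P \<noteq> 0}"
    using t by (simp add: circle_through_def field_simps power2_eq_square)
next
  fix P assume "P \<in> {P \<in> circle_through t. x P \<noteq> 0}"
  then have x0: "x P \<noteq> 0" and eq: "t * ((x P)\<^sup>2 + (y P)\<^sup>2 - c\<^sup>2) = c * (1 - t\<^sup>2) * y P"
    using t by (auto simp: circle_through_def field_simps power2_eq_square)
  define T where "T = (c - t * y P) / x P"
  have T: "T * x P = c - t * y P" using x0 by (simp add: T_def)
  have "T \<noteq> 0"
  proof
    assume "T = 0"
    then have "c = t * y P" using T by simp
    then have "t * (x P)\<^sup>2 = 0" using eq by algebra
    then show False using t x0 by simp
  qed
  have "x P * ((T\<^sup>2 + t\<^sup>2) * x P) = x P * (c * T * (1 + t\<^sup>2))"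
    using T eq by algebra
  then have 1: "(T\<^sup>2 + t\<^sup>2) * x P = c * T * (1 + t\<^sup>2)"
    using x0 by simp
  have "t * ((T\<^sup>2 + t\<^sup>2) * y P) = t * (c * t * (1 - T\<^sup>2))"
    using T 1 by algebra
  then have 2: "(T\<^sup>2 + t\<^sup>2) * y P = c * t * (1 - T\<^sup>2)"
    using t by simp
  have "T\<^sup>2 + t\<^sup>2 \<noteq> 0" using t by (simp add: sum_power2_eq_zero_iff)
  then have "circles_eq c t T (x P) (y P)"
    using 1 2 t \<open>T \<noteq> 0\<close> by (simp add: circles_eq_iff eq_divide_eq mult.commute)
  then show "P \<in> t_curve (circles_eq c) x y t"
    using \<open>T \<noteq> 0\<close> by (auto simp: t_curve_def)
qed

text \<open>
  The dual computation: the base point is \<open>(c/T, 0)\<close>, given by \<open>t = 0\<close>, and for the line from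
  there to the point with parameters \<open>t, T\<close> the ratio \<open>(x - c/T) / y\<close> is \<open>- t / T\<close>.
\<close>

lemma T_curve_circles:
  assumes T: "T \<notin> {0, 1, -1}"
  shows "T_curve (circles_eq c) x y T = {P \<in> circle_around T. y P \<noteq> 0}"
proof (intro equalityI subsetI)
  have T0: "T \<noteq> 0" and T1: "1 - T\<^sup>2 \<noteq> 0" using T square_eq_1[OF T] by auto
  {
    fix P assume "P \<in> T_curve (circles_eq c) x y T"
    then obtain t where t: "t \<noteq> 0" "circles_eq c t T (x P) (y P)"
      by (auto simp: T_curve_def)
    define n where "n = T\<^sup>2 + t\<^sup>2"
    have n: "n \<noteq> 0" using t by (simp add: n_def sum_power2_eq_zero_iff)
    have X: "x P = c * T * (1 + t\<^sup>2) / n" and Y: "y P = c * t * (1 - T\<^sup>2) / n"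
      using t T0 by (simp_all add: circles_eq_iff n_def)
    have X': "n * x P = c * T * (1 + t\<^sup>2)" and Y': "n * y P = c * t * (1 - T\<^sup>2)"
      using X Y n by simp_all
    have "n\<^sup>2 * (T * ((x P)\<^sup>2 + (y P)\<^sup>2 + c\<^sup>2)) = n\<^sup>2 * (c * (1 + T\<^sup>2) * x P)"
      using X' Y' n_def by algebra
    then have "T * ((x P)\<^sup>2 + (y P)\<^sup>2 + c\<^sup>2) = c * (1 + T\<^sup>2) * x P"
      using n by simp
    moreover have "y P \<noteq> 0" using Y n c_pos t T1 by simp
    ultimately show "P \<in> {P \<in> circle_around T. y P \<noteq> 0}"
      using T0 by (simp add: circle_around_def field_simps power2_eq_square)
  next
    fix P assume "P \<in> {P \<in> circle_around T. y P \<noteq> 0}"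
    then have y0: "y P \<noteq> 0" and eq: "T * ((x P)\<^sup>2 + (y P)\<^sup>2 + c\<^sup>2) = c * (1 + T\<^sup>2) * x P"
      using T0 by (auto simp: circle_around_def field_simps power2_eq_square)
    define t where "t = (c - T * x P) / y P"
    have t: "t * y P = c - T * x P" using y0 by (simp add: t_def)
    have "t \<noteq> 0"
    proof
      assume "t = 0"
      then have "c = T * x P" using t by simp
      then have "T * (y P)\<^sup>2 = 0" using eq by algebra
      then show False using T0 y0 by simp
    qed
    have "y P * ((T\<^sup>2 + t\<^sup>2) * y P) = y P * (c * t * (1 - T\<^sup>2))"
      using t eq by algebra
    then have 1: "(T\<^sup>2 + t\<^sup>2) * y P = c * t * (1 - T\<^sup>2)"
      using y0 by simp
    have "T * ((T\<^sup>2 + t\<^sup>2) * x P) = T * (c * T * (1 + t\<^sup>2))"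
      using t 1 by algebra
    then have 2: "(T\<^sup>2 + t\<^sup>2) * x P = c * T * (1 + t\<^sup>2)"
      using T0 by simp
    have "T\<^sup>2 + t\<^sup>2 \<noteq> 0" using T0 by (simp add: sum_power2_eq_zero_iff)
    then have "circles_eq c t T (x P) (y P)"
      using 1 2 T0 \<open>t \<noteq> 0\<close> by (simp add: circles_eq_iff eq_divide_eq mult.commute)
    then show "P \<in> T_curve (circles_eq c) x y T"
      using \<open>t \<noteq> 0\<close> by (auto simp: T_curve_def)
  }
qed

lemma T_curve_circles_limit:
  "T_curve (circles_eq c) x y 1 = {D}" "T_curve (circles_eq c) x y (-1) = {G}"
proof -
  have 1: "circles_eq c t 1 (x P) (y P) \<longleftrightarrow> P = D"
    and 2: "circles_eq c t (-1) (x P) (y P) \<longleftrightarrow> P = G" if "t \<noteq> 0" for t P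
    using that by (simp_all add: circles_eq_iff point_eq_iff)
  have "T_curve (circles_eq c) x y 1 = {P. \<exists>t::real. t \<noteq> 0 \<and> P = D}"
    using 1 unfolding T_curve_def by blast
  then show "T_curve (circles_eq c) x y 1 = {D}"
    by (auto intro: exI[of _ 1])
  have "T_curve (circles_eq c) x y (-1) = {P. \<exists>t::real. t \<noteq> 0 \<and> P = G}"
    using 2 unfolding T_curve_def by blast
  then show "T_curve (circles_eq c) x y (-1) = {G}"
    by (auto intro: exI[of _ 1])
qed

lemma circle_through_iff:
  assumes "b = c * (1 / t - t) / 2"
  shows "P \<in> circle_through t \<longleftrightarrow> (x P)\<^sup>2 + (y P - b)\<^sup>2 = c\<^sup>2 + b\<^sup>2"
proof -
  have b: "c * (1 / t - t) = 2 * b" using assms by simp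
  show ?thesis
    unfolding circle_through_def b by (auto simp: power2_eq_square algebra_simps)
qed

lemma circle_around_iff:
  assumes "d = c * (1 / T + T) / 2"
  shows "P \<in> circle_around T \<longleftrightarrow> (x P - d)\<^sup>2 + (y P)\<^sup>2 = d\<^sup>2 - c\<^sup>2"
proof -
  have d: "c * (1 / T + T) = 2 * d" using assms by simp
  show ?thesis
    unfolding circle_around_def d by (auto simp: power2_eq_square algebra_simps)
qed

lemma circle_through_sphere:
  "circle_through t = sphere (pt 0 (c * (1 / t - t) / 2)) (sqrt (c\<^sup>2 + (c * (1 / t - t) / 2)\<^sup>2))"
  using c_pos by (intro set_eqI, subst mem_sphere_coords)
    (auto simp: circle_through_iff[OF refl] intro!: add_pos_nonneg)

text \<open>The left-hand side is the square of \<open>c (1/T - T) / 2\<close>.\<close>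

lemma circle_around_radius:
  assumes "T \<notin> {0, 1, -1}"
  shows "(c * (1 / T + T) / 2)\<^sup>2 - c\<^sup>2 > 0"
proof -
  have "(c * (1 / T + T) / 2)\<^sup>2 - c\<^sup>2 = (c * (1 / T - T) / 2)\<^sup>2"
    using assms by (simp add: field_simps power2_eq_square)
  moreover have "1 / T - T \<noteq> 0"
    using assms square_eq_1[OF assms] by (auto simp: field_simps power2_eq_square)
  ultimately show ?thesis using c_pos by simp
qed

lemma circle_around_sphere:
  assumes "T \<notin> {0, 1, -1}"
  shows "circle_around T =
    sphere (pt (c * (1 / T + T) / 2) 0) (sqrt ((c * (1 / T + T) / 2)\<^sup>2 - c\<^sup>2))"
  using circle_around_radius[OF assms] by (intro set_eqI, subst mem_sphere_coords)
    (auto simp: circle_around_iff[OF refl])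

text \<open>
  A circle through both points has its centre on the perpendicular bisector, so it is
  determined by the ordinate \<open>c (1/t - t) / 2\<close> of the centre, which takes every real value.
\<close>

lemma elliptic_circle_iff: "elliptic_circle G D S \<longleftrightarrow> (\<exists>t\<in>- {0}. S = circle_through t)"
proof
  assume "elliptic_circle G D S"
  then obtain a r where r: "r > 0" "S = sphere a r" "G \<in> S" "D \<in> S"
    by (auto simp: elliptic_circle_def)
  then have "(- c - x a)\<^sup>2 + (y a)\<^sup>2 = r\<^sup>2" "(c - x a)\<^sup>2 + (y a)\<^sup>2 = r\<^sup>2"
    by (auto simp: mem_sphere_coords simp del: mem_sphere)
  moreover have "(- c - x a)\<^sup>2 - (c - x a)\<^sup>2 = 4 * c * x a"
    by algebra
  ultimately have "c * x a = 0" and r2: "r\<^sup>2 = (c - x a)\<^sup>2 + (y a)\<^sup>2"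
    by linarith+
  then have xa: "x a = 0" using c_pos by simp
  \<comment> \<open>the positive root of \<open>t\<^sup>2 + 2 b t = 1\<close>, where \<open>b\<close> is the ordinate of the centre over \<open>c\<close>\<close>
  define b where "b = y a / c"
  define t where "t = sqrt (b\<^sup>2 + 1) - b"
  have "\<bar>b\<bar> < sqrt (b\<^sup>2 + 1)"
    by (rule real_less_rsqrt) simp
  then have t0: "t \<noteq> 0" by (auto simp: t_def)
  have "(t + b)\<^sup>2 = b\<^sup>2 + 1" by (simp add: t_def)
  then have "1 / t - t = 2 * b" using t0 by (simp add: field_simps power2_eq_square)
  then have b: "c * (1 / t - t) / 2 = y a" using c_pos by (simp add: b_def)
  have "S = circle_through t"
    unfolding circle_through_sphere b
    using r r2 xa by (auto simp: point_eq_iff real_sqrt_unique intro!: arg_cong2[of _ _ _ _ sphere])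
  then show "\<exists>t\<in>- {0}. S = circle_through t" using t0 by blast
next
  assume "\<exists>t\<in>- {0}. S = circle_through t"
  then obtain t where t: "t \<noteq> 0" "S = circle_through t" by auto
  have "c\<^sup>2 + (c * (1 / t - t) / 2)\<^sup>2 > 0" using c_pos by (intro add_pos_nonneg) auto
  moreover have "G \<in> S" "D \<in> S" by (simp_all add: t circle_through_def)
  ultimately show "elliptic_circle G D S"
    unfolding elliptic_circle_def using circle_through_sphere[of t] t(2)
    by (metis real_sqrt_gt_zero)
qed

lemma circle_power_coords: "circle_power a r P = (x P - x a)\<^sup>2 + (y P - y a)\<^sup>2 - r\<^sup>2"
  by (simp add: circle_power_def dist_sq)

text \<open>
  Comparing coefficients in the pencil relation forces \<open>l + m = 1\<close>, a centre \<open>(d, 0)\<close> and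
  \<open>r\<^sup>2 = d\<^sup>2 - c\<^sup>2\<close>. Then \<open>(d + r) (d - r) = c\<^sup>2\<close>, so \<open>T = (d + r) / c\<close> has inverse \<open>(d - r) / c\<close> and
  \<open>c (1/T + T) = 2 d\<close>; it differs from \<open>\<plusminus> 1\<close> as \<open>r \<noteq> 0\<close>.
\<close>

lemma hyperbolic_circle_iff:
  "hyperbolic_circle G D S \<longleftrightarrow> (\<exists>T\<in>- {0, 1, -1}. S = circle_around T)"
proof
  assume "hyperbolic_circle G D S"
  then obtain a r l m where r: "r > 0" "S = sphere a r" and
    pow: "\<And>P. circle_power a r P = l * circle_power G 0 P + m * circle_power D 0 P"
    by (auto simp: hyperbolic_circle_def)
  have eq: "(X - x a)\<^sup>2 + (Y - y a)\<^sup>2 - r\<^sup>2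
      = l * ((X + c)\<^sup>2 + Y\<^sup>2) + m * ((X - c)\<^sup>2 + Y\<^sup>2)" for X Y
    using pow[of "pt X Y"] by (simp add: circle_power_coords)
  \<comment> \<open>three points of the ordinate axis suffice to compare the coefficients\<close>
  note e = eq[of 0 0] eq[of 0 1] eq[of 0 "-1"]
  have ya: "y a = 0" using e by (simp add: power2_eq_square algebra_simps)
  then have lm: "l + m = 1" using e by (simp add: power2_eq_square algebra_simps)
  have "(x a)\<^sup>2 - r\<^sup>2 = (l + m) * c\<^sup>2" using e(1) ya by (simp add: algebra_simps)
  then have r2: "r\<^sup>2 = (x a)\<^sup>2 - c\<^sup>2" using lm by simp
  define T where "T = (x a + r) / c"
  have T: "c * T = x a + r" using c_pos by (simp add: T_def)
  have "(x a + r) * (x a - r) = c\<^sup>2" using r2 by (simp add: power2_eq_square algebra_simps)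
  then have T': "T * (x a - r) = c" using c_pos T by (simp add: T_def power2_eq_square)
  then have T0: "T \<noteq> 0" using c_pos by auto
  have "T \<noteq> 1" "T \<noteq> -1" using T T' r(1) by auto
  then have TI: "T \<in> - {0, 1, -1}" using T0 by simp
  have "c * (1 / T + T) = (c + T * (c * T)) / T" using T0 by (simp add: field_simps)
  also have "c + T * (c * T) = T * (2 * x a)" using T T' by (simp add: algebra_simps)
  finally have d: "c * (1 / T + T) / 2 = x a" using T0 by simp
  have "S = circle_around T"
    using TI r r2 ya by (subst circle_around_sphere)
      (auto simp: d point_eq_iff real_sqrt_unique intro!: arg_cong2[of _ _ _ _ sphere])
  then show "\<exists>T\<in>- {0, 1, -1}. S = circle_around T" using TI by blast
next
  assume "\<exists>T\<in>- {0, 1, -1}. S = circle_around T"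
  then obtain T where T: "T \<notin> {0, 1, -1}" "S = circle_around T" by auto
  define d where "d = c * (1 / T + T) / 2"
  define r where "r = sqrt (d\<^sup>2 - c\<^sup>2)"
  have r: "r > 0" "r\<^sup>2 = d\<^sup>2 - c\<^sup>2"
    using circle_around_radius[OF T(1)] by (simp_all add: r_def d_def)
  define e where "e = d / c"
  have d: "d = e * c" using c_pos by (simp add: e_def)
  have "S = sphere (pt d 0) r"
    using circle_around_sphere[OF T(1)] T(2) by (simp add: d_def r_def)
  moreover have "circle_power (pt d 0) r P = (1 - e) / 2 * circle_power G 0 P
      + (1 + e) / 2 * circle_power D 0 P" for P
    unfolding circle_power_coords r(2) x_pt y_pt xy_foci d
    by (simp add: field_simps power2_eq_square)
  ultimately show "hyperbolic_circle G D S"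
    unfolding hyperbolic_circle_def using r(1) by blast
qed

lemma circles_orthogonal:
  assumes "elliptic_circle G D S" "hyperbolic_circle G D S'"
  shows "orthogonal_circles S S'"
proof -
  obtain t where t: "t \<noteq> 0" "S = circle_through t"
    using assms(1) by (auto simp: elliptic_circle_iff)
  obtain T where T: "T \<notin> {0, 1, -1}" "S' = circle_around T"
    using assms(2) by (auto simp: hyperbolic_circle_iff)
  define b where "b = c * (1 / t - t) / 2"
  define d where "d = c * (1 / T + T) / 2"
  have "c\<^sup>2 + b\<^sup>2 > 0" using c_pos by (intro add_pos_nonneg) auto
  then have b: "sqrt (c\<^sup>2 + b\<^sup>2) > 0" "S = sphere (pt 0 b) (sqrt (c\<^sup>2 + b\<^sup>2))"
    using circle_through_sphere[of t] by (simp_all add: t b_def)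
  have d: "sqrt (d\<^sup>2 - c\<^sup>2) > 0" "S' = sphere (pt d 0) (sqrt (d\<^sup>2 - c\<^sup>2))"
    using circle_around_radius[OF T(1)] circle_around_sphere[OF T(1)] by (simp_all add: T(2) d_def)
  obtain P where P: "circles_eq c t T (x P) (y P)"
    using circles_point_unique[of t T] t T by auto
  have "P \<in> t_curve (circles_eq c) x y t" "P \<in> T_curve (circles_eq c) x y T"
    using P t T by (auto simp: t_curve_def T_curve_def)
  then have "P \<in> S \<inter> S'"
    using t_curve_circles[OF t(1)] T_curve_circles[OF T(1)] t T by auto
  moreover have "(Q - pt 0 b) \<bullet> (Q - pt d 0) = 0" if "Q \<in> S \<inter> S'" for Q
  proof -
    have "(x Q)\<^sup>2 + (y Q)\<^sup>2 - c\<^sup>2 = 2 * b * y Q" "(x Q)\<^sup>2 + (y Q)\<^sup>2 + c\<^sup>2 = 2 * d * x Q"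
      using that by (auto simp: t T circle_through_def circle_around_def b_def d_def)
    then show ?thesis
      unfolding inner_coords x_pt y_pt by (simp add: power2_eq_square algebra_simps)
  qed
  ultimately show ?thesis
    unfolding orthogonal_circles_def using b d by blast
qed

lemma circles_t_describes:
  "describes (t_curve (circles_eq c) x y) (- {0}) x (elliptic_circle G D)"
proof (rule describesI[where K = circle_through])
  fix t :: real
  define b where "b = c * (1 / t - t) / 2"
  have "c\<^sup>2 + b\<^sup>2 > 0" using c_pos by (intro add_pos_nonneg) auto
  then have "(c\<^sup>2 + b\<^sup>2) * (1 + (- 1 / (c\<^sup>2 + b\<^sup>2)) * z) = c\<^sup>2 + b\<^sup>2 - z" for z
    by (intro rescale) linarith
  then have "circle_through t = {P. (y P - b)\<^sup>2 = (c\<^sup>2 + b\<^sup>2) * (1 + (- 1 / (c\<^sup>2 + b\<^sup>2)) * (x P)\<^sup>2)}"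
    by (auto simp: circle_through_iff[OF b_def])
  then show "closure {P \<in> circle_through t. x P \<noteq> 0} = circle_through t"
    by (rule closure_off_y_axis)
qed (auto simp: t_curve_circles elliptic_circle_iff)

lemma circles_T_describes:
  "describes (T_curve (circles_eq c) x y) (- {0, 1, -1}) y (hyperbolic_circle G D)"
proof (rule describesI[where K = circle_around])
  fix T :: real assume T: "T \<in> - {0, 1, -1}"
  define d where "d = c * (1 / T + T) / 2"
  have "d\<^sup>2 - c\<^sup>2 > 0" using T circle_around_radius[of T] by (simp add: d_def)
  then have "(d\<^sup>2 - c\<^sup>2) * (1 + (- 1 / (d\<^sup>2 - c\<^sup>2)) * z) = d\<^sup>2 - c\<^sup>2 - z" for z
    by (intro rescale) linarith
  then have "circle_around T = {P. (x P - d)\<^sup>2 = (d\<^sup>2 - c\<^sup>2) * (1 + (- 1 / (d\<^sup>2 - c\<^sup>2)) * (y P)\<^sup>2)}"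
    by (auto simp: circle_around_iff[OF d_def])
  then show "closure {P \<in> circle_around T. y P \<noteq> 0} = circle_around T"
    by (rule closure_off_x_axis)
qed (auto simp: T_curve_circles hyperbolic_circle_iff)

section \<open>The confocal conics\<close>

text \<open>
  The equation \<open>x\<^sup>2 / a\<^sup>2 + y\<^sup>2 / (a\<^sup>2 - c\<^sup>2) = 1\<close> without denominators: an ellipse for \<open>a > c\<close> and a
  hyperbola for \<open>0 < a < c\<close>. Only \<open>a\<^sup>2\<close> enters, so the signs of the parameters do not matter.
\<close>

definition confocal_conic :: "real \<Rightarrow> (real^2) set" where
  "confocal_conic a = {P. (a\<^sup>2 - c\<^sup>2) * (x P)\<^sup>2 + a\<^sup>2 * (y P)\<^sup>2 = a\<^sup>2 * (a\<^sup>2 - c\<^sup>2)}"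

lemma confocal_conic_abs: "confocal_conic \<bar>a\<bar> = confocal_conic a"
  by (simp add: confocal_conic_def)

lemma dist_foci: "dist G D = 2 * c"
proof -
  have "(dist G D)\<^sup>2 = (2 * c)\<^sup>2" by (simp add: dist_sq)
  then show ?thesis by (rule power2_eq_imp_eq) (use c_pos in simp_all)
qed

text \<open>
  The two metric conditions squared are \<open>(g + d)\<^sup>2 = 4 a\<^sup>2\<close> and \<open>(g - d)\<^sup>2 = 4 a\<^sup>2\<close>. Their product
  involves only \<open>g\<^sup>2 + d\<^sup>2\<close> and \<open>g\<^sup>2 - d\<^sup>2\<close>, which are polynomials in the coordinates, so both
  square roots disappear and the equation of the conic remains.
\<close>

lemma confocal_conic_iff:
  assumes "a > 0"
  shows "P \<in> confocal_conic a \<longleftrightarrow>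
    dist P G + dist P D = 2 * a \<or> \<bar>dist P G - dist P D\<bar> = 2 * a"
proof -
  define g where "g = dist P G"
  define d where "d = dist P D"
  have g: "g\<^sup>2 = (x P + c)\<^sup>2 + (y P)\<^sup>2" and d: "d\<^sup>2 = (x P - c)\<^sup>2 + (y P)\<^sup>2"
    by (simp_all add: g_def d_def dist_sq)
  have "((g + d)\<^sup>2 - (2 * a)\<^sup>2) * ((g - d)\<^sup>2 - (2 * a)\<^sup>2)
      = 16 * (a\<^sup>2 * (a\<^sup>2 - c\<^sup>2) - ((a\<^sup>2 - c\<^sup>2) * (x P)\<^sup>2 + a\<^sup>2 * (y P)\<^sup>2))"
    using g d by algebra
  moreover have "P \<in> confocal_conic a \<longleftrightarrow>
      16 * (a\<^sup>2 * (a\<^sup>2 - c\<^sup>2) - ((a\<^sup>2 - c\<^sup>2) * (x P)\<^sup>2 + a\<^sup>2 * (y P)\<^sup>2)) = 0"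
    by (auto simp: confocal_conic_def)
  ultimately have "P \<in> confocal_conic a \<longleftrightarrow>
      ((g + d)\<^sup>2 - (2 * a)\<^sup>2) * ((g - d)\<^sup>2 - (2 * a)\<^sup>2) = 0"
    by simp
  also have "\<dots> \<longleftrightarrow> (g + d)\<^sup>2 = (2 * a)\<^sup>2 \<or> (g - d)\<^sup>2 = (2 * a)\<^sup>2"
    by (simp only: mult_eq_0_iff right_minus_eq)
  also have "(g + d)\<^sup>2 = (2 * a)\<^sup>2 \<longleftrightarrow> g + d = 2 * a"
    using assms by (intro power2_eq_iff_nonneg) (simp_all add: g_def d_def)
  also have "(g - d)\<^sup>2 = (2 * a)\<^sup>2 \<longleftrightarrow> \<bar>g - d\<bar> = 2 * a"
    using power2_eq_iff_nonneg[of "\<bar>g - d\<bar>" "2 * a"] assms by simp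
  finally show ?thesis by (simp add: g_def d_def)
qed

lemma dist_foci_bounds:
  "2 * c \<le> dist P G + dist P D" "\<bar>dist P G - dist P D\<bar> \<le> 2 * c"
  using dist_triangle[of G D P] dist_triangle[of P G D] dist_triangle[of P D G] dist_foci
  by (auto simp: dist_commute)

lemma ellipse_eq_confocal_conic:
  assumes "c < a"
  shows "{P. dist P G + dist P D = 2 * a} = confocal_conic a"
proof -
  have "\<bar>dist P G - dist P D\<bar> \<noteq> 2 * a" for P
    using dist_foci_bounds(2)[of P] assms by linarith
  then show ?thesis
    using c_pos assms by (auto simp: confocal_conic_iff)
qed

lemma hyperbola_eq_confocal_conic:
  assumes "0 < a" "a < c"
  shows "{P. \<bar>dist P G - dist P D\<bar> = 2 * a} = confocal_conic a"
proof -
  have "dist P G + dist P D \<noteq> 2 * a" for P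
    using dist_foci_bounds(1)[of P] assms by linarith
  then show ?thesis
    using assms by (auto simp: confocal_conic_iff)
qed

lemma confocal_ellipse_iff:
  assumes "b \<noteq> 0" "a\<^sup>2 = c\<^sup>2 + b\<^sup>2"
  shows "P \<in> confocal_conic a \<longleftrightarrow> (x P / a)\<^sup>2 + (y P / b)\<^sup>2 = 1"
proof -
  have "a \<noteq> 0" using assms by (auto simp: sum_power2_eq_zero_iff)
  have "a\<^sup>2 - c\<^sup>2 = b\<^sup>2" using assms(2) by simp
  then have "P \<in> confocal_conic a \<longleftrightarrow> b\<^sup>2 * (x P)\<^sup>2 + a\<^sup>2 * (y P)\<^sup>2 = a\<^sup>2 * b\<^sup>2"
    by (simp only: confocal_conic_def mem_Collect_eq)
  then show ?thesis
    using \<open>a \<noteq> 0\<close> assms(1) by (auto simp: power_divide field_simps)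
qed

lemma confocal_hyperbola_iff:
  assumes "a \<noteq> 0" "b \<noteq> 0" "c\<^sup>2 = a\<^sup>2 + b\<^sup>2"
  shows "P \<in> confocal_conic a \<longleftrightarrow> (x P / a)\<^sup>2 - (y P / b)\<^sup>2 = 1"
  using assms(1,2) unfolding confocal_conic_def assms(3) power_divide
  by (simp add: field_simps)

text \<open>
  Semi-axes along the focal line, up to sign. The ones across it are
  \<open>c (2 t / (1 - t\<^sup>2))\<close> and \<open>c ((1 - T\<^sup>2) / (1 + T\<^sup>2))\<close>.
\<close>

definition ellipse_axis :: "real \<Rightarrow> real" where
  "ellipse_axis t = c * ((1 + t\<^sup>2) / (1 - t\<^sup>2))"

definition hyperbola_axis :: "real \<Rightarrow> real" where
  "hyperbola_axis T = c * (2 * T / (1 + T\<^sup>2))"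

lemma ellipse_axes:
  assumes "t \<notin> {0, 1, -1}"
  shows "c * (2 * t / (1 - t\<^sup>2)) \<noteq> 0" "(ellipse_axis t)\<^sup>2 = c\<^sup>2 + (c * (2 * t / (1 - t\<^sup>2)))\<^sup>2"
proof -
  have "((1 + t\<^sup>2) / (1 - t\<^sup>2))\<^sup>2 - (2 * t / (1 - t\<^sup>2))\<^sup>2 = 1"
    using unit_hyperbola_rational square_eq_1[OF assms] assms by blast
  then show "(ellipse_axis t)\<^sup>2 = c\<^sup>2 + (c * (2 * t / (1 - t\<^sup>2)))\<^sup>2"
    unfolding ellipse_axis_def power_mult_distrib by algebra
  show "c * (2 * t / (1 - t\<^sup>2)) \<noteq> 0"
    using square_eq_1[OF assms] assms c_pos by simp
qed

lemma hyperbola_axes: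
  assumes "T \<notin> {0, 1, -1}"
  shows "hyperbola_axis T \<noteq> 0" "c * ((1 - T\<^sup>2) / (1 + T\<^sup>2)) \<noteq> 0"
    "c\<^sup>2 = (hyperbola_axis T)\<^sup>2 + (c * ((1 - T\<^sup>2) / (1 + T\<^sup>2)))\<^sup>2"
proof -
  have "(2 * T / (1 + T\<^sup>2))\<^sup>2 + ((1 - T\<^sup>2) / (1 + T\<^sup>2))\<^sup>2 = 1"
    using unit_circle_rational assms by blast
  then show "c\<^sup>2 = (hyperbola_axis T)\<^sup>2 + (c * ((1 - T\<^sup>2) / (1 + T\<^sup>2)))\<^sup>2"
    unfolding hyperbola_axis_def power_mult_distrib by algebra
  show "hyperbola_axis T \<noteq> 0" "c * ((1 - T\<^sup>2) / (1 + T\<^sup>2)) \<noteq> 0"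
    using square_eq_1[OF assms] assms c_pos by (simp_all add: hyperbola_axis_def)
qed

text \<open>
  A ratio \<open>a / c > 1\<close> is the abscissa of a point of the unit hyperbola off its vertices, and the
  rational parametrisation of the latter supplies \<open>t\<close>.
\<close>

lemma ellipse_iff:
  "ellipse_with_foci G D S \<longleftrightarrow> (\<exists>t\<in>- {0, 1, -1}. S = confocal_conic (ellipse_axis t))"
proof
  assume "ellipse_with_foci G D S"
  then obtain a where "2 * c < 2 * a" "S = {P. dist P G + dist P D = 2 * a}"
    unfolding ellipse_with_foci_def dist_foci by blast
  then have a: "c < a" "S = confocal_conic a"
    using ellipse_eq_confocal_conic[of a] by simp_all
  have "a / c > 1" using a(1) c_pos by simp
  then have "(a / c)\<^sup>2 > 1" by (rule one_less_power) simp
  then have "sqrt ((a / c)\<^sup>2 - 1) \<noteq> 0 \<and> (a / c)\<^sup>2 - (sqrt ((a / c)\<^sup>2 - 1))\<^sup>2 = 1" by simp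
  then obtain t where "t \<noteq> 0" "t\<^sup>2 \<noteq> 1" "a / c = (1 + t\<^sup>2) / (1 - t\<^sup>2)"
    unfolding unit_hyperbola_rational[symmetric] by blast
  then have "t \<in> - {0, 1, -1}" "a = ellipse_axis t"
    using c_pos by (auto simp: ellipse_axis_def field_simps)
  then show "\<exists>t\<in>- {0, 1, -1}. S = confocal_conic (ellipse_axis t)" using a(2) by blast
next
  assume "\<exists>t\<in>- {0, 1, -1}. S = confocal_conic (ellipse_axis t)"
  then obtain t where t: "t \<notin> {0, 1, -1}" "S = confocal_conic (ellipse_axis t)" by auto
  have "c\<^sup>2 < (ellipse_axis t)\<^sup>2" using ellipse_axes[OF t(1)] by simp
  then have "c < \<bar>ellipse_axis t\<bar>" using c_pos by (intro power_less_imp_less_base[of c 2]) auto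
  then show "ellipse_with_foci G D S"
    unfolding ellipse_with_foci_def dist_foci
    using t(2) ellipse_eq_confocal_conic[of "\<bar>ellipse_axis t\<bar>"]
    by (intro exI[of _ "\<bar>ellipse_axis t\<bar>"]) (simp add: confocal_conic_abs)
qed

text \<open>
  As for ellipses, with the unit circle in place of the unit hyperbola: \<open>0 < a / c < 1\<close> is the
  abscissa of a point of the circle that is on neither axis.
\<close>

lemma hyperbola_iff:
  "hyperbola_with_foci G D S \<longleftrightarrow> (\<exists>T\<in>- {0, 1, -1}. S = confocal_conic (hyperbola_axis T))"
proof
  assume "hyperbola_with_foci G D S"
  then obtain a where "0 < a" "2 * a < 2 * c" "S = {P. \<bar>dist P G - dist P D\<bar> = 2 * a}"
    unfolding hyperbola_with_foci_def dist_foci by blast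
  then have a: "0 < a" "a < c" "S = confocal_conic a"
    using hyperbola_eq_confocal_conic[of a] by simp_all
  have lt: "(a / c)\<^sup>2 < 1" using a(1,2) c_pos by (simp add: abs_square_less_1 del: power_divide)
  then have "a / c \<noteq> 0 \<and> (a / c)\<^sup>2 + (sqrt (1 - (a / c)\<^sup>2))\<^sup>2 = 1" using a c_pos by simp
  then obtain T where T: "T \<noteq> 0" "a / c = 2 * T / (1 + T\<^sup>2)"
    "sqrt (1 - (a / c)\<^sup>2) = (1 - T\<^sup>2) / (1 + T\<^sup>2)"
    unfolding unit_circle_rational[symmetric] by blast
  have "T\<^sup>2 \<noteq> 1" using T(3) lt by auto
  then have "T \<in> - {0, 1, -1}" using T(1) by auto
  moreover have "a = hyperbola_axis T"
    using c_pos by (simp only: hyperbola_axis_def flip: T(2)) simp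
  ultimately show "\<exists>T\<in>- {0, 1, -1}. S = confocal_conic (hyperbola_axis T)" using a(3) by blast
next
  assume "\<exists>T\<in>- {0, 1, -1}. S = confocal_conic (hyperbola_axis T)"
  then obtain T where T: "T \<notin> {0, 1, -1}" "S = confocal_conic (hyperbola_axis T)" by auto
  have "(hyperbola_axis T)\<^sup>2 < c\<^sup>2" using hyperbola_axes(2,3)[OF T(1)] by simp
  then have "\<bar>hyperbola_axis T\<bar> < c" using c_pos by (intro power_less_imp_less_base[of _ 2 c]) auto
  then show "hyperbola_with_foci G D S"
    unfolding hyperbola_with_foci_def dist_foci
    using T(2) hyperbola_eq_confocal_conic[of "\<bar>hyperbola_axis T\<bar>"] hyperbola_axes(1)[OF T(1)]
    by (intro exI[of _ "\<bar>hyperbola_axis T\<bar>"]) (simp add: confocal_conic_abs)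
qed

lemma conics_point_unique:
  assumes "t \<notin> {0, 1, -1}" "T \<noteq> 0"
  shows "\<exists>!P. conics_eq c t T (x P) (y P)"
proof -
  have "conics_eq c t T (x P) (y P) \<longleftrightarrow>
      P = pt (c * ((1 + t\<^sup>2) / (1 - t\<^sup>2)) * (2 * T / (1 + T\<^sup>2)))
             (c * (2 * t / (1 - t\<^sup>2)) * ((1 - T\<^sup>2) / (1 + T\<^sup>2)))" for P
    using assms square_eq_1[OF assms(1)] c_pos unfolding point_eq_iff
    by (subst conics_eq_iff) simp_all
  then show ?thesis by simp
qed

text \<open>
  Dividing the coordinates by the semi-axes turns the ellipse into the unit circle, and
  \<open>T\<close> into the rational parameter of that circle.
\<close>

lemma t_curve_conics:
  assumes t: "t \<notin> {0, 1, -1}"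
  shows "t_curve (conics_eq c) x y t = {P \<in> confocal_conic (ellipse_axis t). x P \<noteq> 0}"
proof -
  define b where "b = c * (2 * t / (1 - t\<^sup>2))"
  have b: "b \<noteq> 0" "(ellipse_axis t)\<^sup>2 = c\<^sup>2 + b\<^sup>2"
    using ellipse_axes[OF t] by (simp_all add: b_def)
  then have a0: "ellipse_axis t \<noteq> 0" by (auto simp: sum_power2_eq_zero_iff)
  have "P \<in> t_curve (conics_eq c) x y t \<longleftrightarrow>
    P \<in> confocal_conic (ellipse_axis t) \<and> x P \<noteq> 0" for P
  proof -
    have "P \<in> t_curve (conics_eq c) x y t \<longleftrightarrow>
      (\<exists>T. T \<noteq> 0 \<and> x P = ellipse_axis t * (2 * T / (1 + T\<^sup>2)) \<and> y P = b * ((1 - T\<^sup>2) / (1 + T\<^sup>2)))"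
      using t square_eq_1[OF t] c_pos conics_eq_iff[of t _ c]
      by (auto simp: t_curve_def ellipse_axis_def b_def simp del: times_divide_eq_right)
    also have "\<dots> \<longleftrightarrow> (\<exists>T. T \<noteq> 0 \<and> x P / ellipse_axis t = 2 * T / (1 + T\<^sup>2) \<and>
        y P / b = (1 - T\<^sup>2) / (1 + T\<^sup>2))"
      using a0 b(1) by (simp add: divide_eq_eq mult.commute)
    also have "\<dots> \<longleftrightarrow> P \<in> confocal_conic (ellipse_axis t) \<and> x P \<noteq> 0"
      using a0 unfolding unit_circle_rational confocal_ellipse_iff[OF b] by auto
    finally show ?thesis .
  qed
  then show ?thesis by blast
qed

text \<open>
  Dividing by the semi-axes turns the hyperbola into the unit hyperbola with the rational
  parameter \<open>t\<close>; both branches are covered, the second one by \<open>t\<^sup>2 > 1\<close>.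
\<close>

lemma T_curve_conics:
  assumes T: "T \<notin> {0, 1, -1}"
  shows "T_curve (conics_eq c) x y T = {P \<in> confocal_conic (hyperbola_axis T). y P \<noteq> 0}"
proof -
  define b where "b = c * ((1 - T\<^sup>2) / (1 + T\<^sup>2))"
  have b: "hyperbola_axis T \<noteq> 0" "b \<noteq> 0" "c\<^sup>2 = (hyperbola_axis T)\<^sup>2 + b\<^sup>2"
    using hyperbola_axes[OF T] by (simp_all add: b_def)
  have "P \<in> T_curve (conics_eq c) x y T \<longleftrightarrow>
    P \<in> confocal_conic (hyperbola_axis T) \<and> y P \<noteq> 0" for P
  proof -
    have "P \<in> T_curve (conics_eq c) x y T \<longleftrightarrow>
      (\<exists>t. t \<noteq> 0 \<and> t\<^sup>2 \<noteq> 1 \<and> x P = hyperbola_axis T * ((1 + t\<^sup>2) / (1 - t\<^sup>2)) \<and>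
        y P = b * (2 * t / (1 - t\<^sup>2)))"
      using T c_pos conics_eq_iff[of _ T c]
      by (auto simp: T_curve_def hyperbola_axis_def b_def mult_ac
          simp del: times_divide_eq_right times_divide_eq_left)
    also have "\<dots> \<longleftrightarrow> (\<exists>t. t \<noteq> 0 \<and> t\<^sup>2 \<noteq> 1 \<and> x P / hyperbola_axis T = (1 + t\<^sup>2) / (1 - t\<^sup>2) \<and>
        y P / b = 2 * t / (1 - t\<^sup>2))"
      using b by (simp add: divide_eq_eq mult.commute)
    also have "\<dots> \<longleftrightarrow> P \<in> confocal_conic (hyperbola_axis T) \<and> y P \<noteq> 0"
      using b unfolding unit_hyperbola_rational confocal_hyperbola_iff[OF b] by auto
    finally show ?thesis .
  qed
  then show ?thesis by blast
qed

lemma conics_t_describes: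
  "describes (t_curve (conics_eq c) x y) (- {0, 1, -1}) x (ellipse_with_foci G D)"
proof (rule describesI[where K = "\<lambda>t. confocal_conic (ellipse_axis t)"])
  fix t :: real assume t: "t \<in> - {0, 1, -1}"
  define a where "a = ellipse_axis t"
  define b where "b = c * (2 * t / (1 - t\<^sup>2))"
  have b: "b \<noteq> 0" "a\<^sup>2 = c\<^sup>2 + b\<^sup>2"
    using ellipse_axes[of t] t by (simp_all add: a_def b_def)
  then have "a \<noteq> 0" by (auto simp: sum_power2_eq_zero_iff)
  then have "confocal_conic a = {P. (y P - 0)\<^sup>2 = b\<^sup>2 * (1 + (- 1 / a\<^sup>2) * (x P)\<^sup>2)}"
    using b(1) by (auto simp: confocal_ellipse_iff[OF b] power_divide field_simps)
  then show "closure {P \<in> confocal_conic (ellipse_axis t). x P \<noteq> 0}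
      = confocal_conic (ellipse_axis t)"
    unfolding a_def by (rule closure_off_y_axis)
qed (auto simp: t_curve_conics ellipse_iff)

lemma conics_T_describes:
  "describes (T_curve (conics_eq c) x y) (- {0, 1, -1}) y (hyperbola_with_foci G D)"
proof (rule describesI[where K = "\<lambda>T. confocal_conic (hyperbola_axis T)"])
  fix T :: real assume T: "T \<in> - {0, 1, -1}"
  define a where "a = hyperbola_axis T"
  define b where "b = c * ((1 - T\<^sup>2) / (1 + T\<^sup>2))"
  have b: "a \<noteq> 0" "b \<noteq> 0" "c\<^sup>2 = a\<^sup>2 + b\<^sup>2"
    using hyperbola_axes[of T] T by (simp_all add: a_def b_def)
  then have "confocal_conic a = {P. (x P - 0)\<^sup>2 = a\<^sup>2 * (1 + (1 / b\<^sup>2) * (y P)\<^sup>2)}"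
    by (auto simp: confocal_hyperbola_iff[OF b] power_divide field_simps)
  then show "closure {P \<in> confocal_conic (hyperbola_axis T). y P \<noteq> 0}
      = confocal_conic (hyperbola_axis T)"
    unfolding a_def by (rule closure_off_x_axis)
qed (auto simp: T_curve_conics hyperbola_iff)

end

section \<open>Independence of the orientation of the axis\<close>

lemma elliptic_circle_commute: "elliptic_circle G D = elliptic_circle D G"
  by (auto simp: elliptic_circle_def fun_eq_iff)

lemma hyperbolic_circle_commute: "hyperbolic_circle G D = hyperbolic_circle D G"
proof -
  have "hyperbolic_circle D G S" if "hyperbolic_circle G D S" for G D S
    using that unfolding hyperbolic_circle_def by (metis add.commute)
  then show ?thesis by blast
qed

lemma ellipse_with_foci_commute: "ellipse_with_foci G D = ellipse_with_foci D G"
  by (simp add: ellipse_with_foci_def fun_eq_iff dist_commute[of G D] add.commute)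

lemma hyperbola_with_foci_commute: "hyperbola_with_foci G D = hyperbola_with_foci D G"
  by (simp add: hyperbola_with_foci_def fun_eq_iff dist_commute[of G D] abs_minus_commute)

lemma cartesian_coords_focal_frame:
  assumes "c > 0" and "dist G D = 2 * c" and "cartesian_coords G D x y"
  obtains u v where "focal_frame G D u v c x y" | u v where "focal_frame D G u v c x y"
proof -
  obtain u v where uv: "norm u = 1" "norm v = 1" "u \<bullet> v = 0" "D - G \<in> span {u}"
    "\<And>P. x P = (P - midpoint G D) \<bullet> u" "\<And>P. y P = (P - midpoint G D) \<bullet> v"
    using assms(3) by (auto simp: cartesian_coords_def)
  obtain k where k: "D - G = k *\<^sub>R u"
    using uv(4) by (auto simp: span_singleton)
  have "\<bar>k\<bar> = 2 * c"
    using assms(2) k uv(1) by (metis dist_commute dist_norm norm_scaleR mult_1_right)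
  then consider "k = 2 * c" | "k = - 2 * c" by linarith
  then show thesis
  proof cases
    case 1
    then have "focal_frame G D u v c x y"
      using assms(1) uv k by unfold_locales auto
    then show thesis by (rule that(1))
  next
    case 2
    then have "G - D = (2 * c) *\<^sub>R u"
      using k by (simp add: algebra_simps)
    then have "focal_frame D G u v c x y"
      using assms(1) uv by unfold_locales (auto simp: midpoint_sym)
    then show thesis by (rule that(2))
  qed
qed

theorem theorem1:
  fixes G D :: "real^2" and c :: real and x y :: "real^2 \<Rightarrow> real"
  assumes "c > 0" and "dist G D = 2 * c" and "cartesian_coords G D x y"
  shows
    "(\<forall>t T. t \<noteq> 0 \<longrightarrow> T \<noteq> 0 \<longrightarrow> (\<exists>!P. circles_eq c t T (x P) (y P))) \<and>
     describes (t_curve (circles_eq c) x y) (- {0}) x (elliptic_circle G D) \<and>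
     describes (T_curve (circles_eq c) x y) (- {0, 1, -1}) y (hyperbolic_circle G D) \<and>
     {T_curve (circles_eq c) x y 1, T_curve (circles_eq c) x y (-1)} = {{G}, {D}} \<and>
     (\<forall>S S'. elliptic_circle G D S \<longrightarrow> hyperbolic_circle G D S' \<longrightarrow> orthogonal_circles S S') \<and>
     (\<forall>t T. t \<notin> {0, 1, -1} \<longrightarrow> T \<noteq> 0 \<longrightarrow> (\<exists>!P. conics_eq c t T (x P) (y P))) \<and>
     describes (t_curve (conics_eq c) x y) (- {0, 1, -1}) x (ellipse_with_foci G D) \<and>
     describes (T_curve (conics_eq c) x y) (- {0, 1, -1}) y (hyperbola_with_foci G D)"
  using assms
proof (cases rule: cartesian_coords_focal_frame)
  case (1 u v)
  then interpret focal_frame G D u v c x y .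
  show ?thesis
    using circles_point_unique circles_t_describes circles_T_describes T_curve_circles_limit
      circles_orthogonal conics_point_unique conics_t_describes conics_T_describes
    by (simp add: insert_commute)
next
  case (2 u v)
  then interpret focal_frame D G u v c x y .
  show ?thesis
    unfolding elliptic_circle_commute[of G D] hyperbolic_circle_commute[of G D]
      ellipse_with_foci_commute[of G D] hyperbola_with_foci_commute[of G D]
    using circles_point_unique circles_t_describes circles_T_describes T_curve_circles_limit
      circles_orthogonal conics_point_unique conics_t_describes conics_T_describes
    by simp
qed

end
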